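(* Let $n\ge 1$ and let $\mathbf{k}=(k_1,\dots,k_n)$ be integers with $k_j\ge 2$ for all $j$. The following are equivalent. (a) For any two sacks $\mathbf{S}=(\mathbf{p}^1,\dots,\mathbf{p}^n)$ and $\mathbf{S}'=(\mathbf{q}^1,\dots,\mathbf{q}^n)$ of pseudodice of type $\mathbf{k}$ having the same total probability distribution, there is a permutation $\sigma$ of $\{1,\dots,n\}$ with $\mathbf{q}^j=\mathbf{p}^{\sigma(j)}$ for all $j$. (b) Either $k_j=2$ for all $j$ (a sack of coins), or $n=1$ (a singleton sack).
   Context: A pseudodie of order $k\ge 2$ is a vector $\mathbf{p}=(p_0,\dots,p_{k-1})\in\mathbb{C}^k$ with $\sum_{i=0}^{k-1}p_i=1$. A coin is a die of order $2$. A sack of type $\mathbf{k}=(k_1,\dots,k_n)$ is an ordered tuple $\mathbf{S}=(\mathbf{p}^1,\dots,\mathbf{p}^n)$ where $\mathbf{p}^j=(p^j_0,\dots,p^j_{k_j-1})$ is a pseudodie of order $k_j$. With $T=\sum_{j=1}^n(k_j-1)$, the total probability distribution of $\mathbf{S}$ is the vector $(f_0,\dots,f_T)$ with $$f_t=\sum_{\substack{(i_1,\dots,i_n)\\ 0\le i_j\le k_j-1,\; i_1+\dots+i_n=t}}\ \prod_{j=1}^n p^j_{i_j}.$$ *)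

theory Defs
  imports Complex_Main "HOL-Combinatorics.Permutations"
begin

text \<open>
  Finite tuples are lists, indexed from 0: the tuple \<open>(k\<^sub>1, \<dots>, k\<^sub>n)\<close> is a list \<open>ks\<close> with
  \<open>k\<^sub>j = ks ! (j - 1)\<close>. A vector in \<open>\<complex>\<^sup>k\<close> is a \<open>complex list\<close> of length \<open>k\<close>.
\<close>

definition pseudodie :: "nat \<Rightarrow> complex list \<Rightarrow> bool" where
  "pseudodie k p \<longleftrightarrow> k \<ge> 2 \<and> length p = k \<and> (\<Sum>i<k. p ! i) = 1"

definition sack :: "nat list \<Rightarrow> complex list list \<Rightarrow> bool" where
  "sack ks S \<longleftrightarrow> length S = length ks \<and> (\<forall>j<length ks. pseudodie (ks ! j) (S ! j))"

definition max_total :: "nat list \<Rightarrow> nat" where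
  "max_total ks = (\<Sum>j<length ks. (ks ! j - 1))"

definition outcomes :: "nat list \<Rightarrow> nat \<Rightarrow> nat list set" where
  "outcomes ks t =
     {is. length is = length ks \<and> (\<forall>j<length ks. is ! j \<le> ks ! j - 1) \<and>
          (\<Sum>j<length ks. is ! j) = t}"

text \<open>The vector \<open>(f\<^sub>0, \<dots>, f\<^sub>T)\<close>, where \<open>T = max_total ks\<close>.\<close>

definition total_distribution :: "nat list \<Rightarrow> complex list list \<Rightarrow> complex list" where
  "total_distribution ks S =
     map (\<lambda>t. \<Sum>is\<in>outcomes ks t. \<Prod>j<length ks. S ! j ! (is ! j)) [0..<Suc (max_total ks)]"

end

theory Submission
  imports Defs "HOL-Computational_Algebra.Polynomial" "HOL-Library.FuncSet"
begin

text \<open>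
  Read a die \<open>p\<close> as the polynomial \<open>p\<^sub>0 + p\<^sub>1 x + \<dots>\<close> (the library's \<^const>\<open>Poly\<close>). Its value at 1 is 1,
  and the total distribution of a sack lists the coefficients of the product of the polynomials of
  its dice (\<open>coeff_prod_Poly\<close>). The question is therefore when a polynomial determines
  its factorization into factors of prescribed maximal degrees and value 1 at 1.

  For coins it does. All factors are linear or constant, a linear factor is determined by its root
  because its value at 1 fixes the scaling, and a constant factor is 1. So roots can be matched and
  cancelled one by one (\<open>coin_factorization_unique\<close>). For a single die the product is the
  die itself.

  If there are at least two dice, one of order at least 3, the factorizations
  \<open>x\<^sup>2 \<cdot> 1 = x \<cdot> x\<close> give two different sacks with the same total: every die shows a fixed number, the
  large die and another one showing 2 and 0 in one sack, 1 and 1 in the other, and the remaining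
  dice showing 0.
\<close>

section \<open>Dice as polynomials\<close>

lemma Poly_eq_sum_monom: "Poly p = (\<Sum>i<length p. monom (p ! i) i)"
  by (rule poly_eqI) (simp add: coeff_sum nth_default_def sum.delta if_distrib cong: if_cong)

lemma Poly_inject_same_length:
  assumes "Poly p = Poly q" "length p = length q"
  shows "p = q"
proof (rule nth_equalityI)
  fix i assume "i < length p"
  moreover have "coeff (Poly p) i = coeff (Poly q) i"
    using assms by simp
  ultimately show "p ! i = q ! i"
    using assms(2) by (simp add: nth_default_def)
qed fact

lemma poly_Poly_at_1:
  fixes p :: "'a::comm_semiring_1 list"
  shows "poly (Poly p) 1 = (\<Sum>i<length p. p ! i)"
  by (simp add: Poly_eq_sum_monom poly_sum poly_monom)

lemma pseudodie_poly_at_1: "pseudodie k p \<Longrightarrow> poly (Poly p) 1 = 1"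
  by (auto simp: pseudodie_def poly_Poly_at_1)

lemma prod_monom:
  "finite A \<Longrightarrow> (\<Prod>j\<in>A. monom (c j) (e j)) = monom (\<Prod>j\<in>A. c j) (\<Sum>j\<in>A. e j)"
  by (induction A rule: finite_induct) (simp_all add: mult_monom)

section \<open>The total distribution as a product of polynomials\<close>

text \<open>
  Expanding the product picks one face from each die. The library's expansion is indexed by choice
  functions, which are the outcome lists in another guise.
\<close>

lemma coeff_prod_Poly:
  assumes "sack ks S"
  shows "coeff (\<Prod>j<length ks. Poly (S ! j)) t =
    (\<Sum>is\<in>outcomes ks t. \<Prod>j<length ks. S ! j ! (is ! j))"
proof -
  let ?n = "length ks"
  let ?F = "PiE {..<?n} (\<lambda>j. {..<ks ! j})"
  have len: "length (S ! j) = ks ! j" and pos: "ks ! j \<ge> 2" if "j < ?n" for j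
    using assms that by (auto simp: sack_def pseudodie_def)
  have fin: "finite ?F"
    by (intro finite_PiE) auto
  have "(\<Prod>j<?n. Poly (S ! j)) = (\<Prod>j<?n. \<Sum>i<ks ! j. monom (S ! j ! i) i)"
    by (intro prod.cong) (auto simp: Poly_eq_sum_monom len)
  also have "\<dots> = (\<Sum>g\<in>?F. \<Prod>j<?n. monom (S ! j ! g j) (g j))"
    by (rule prod_sum_PiE) auto
  also have "\<dots> = (\<Sum>g\<in>?F. monom (\<Prod>j<?n. S ! j ! g j) (\<Sum>j<?n. g j))"
    by (simp add: prod_monom)
  finally have "coeff (\<Prod>j<?n. Poly (S ! j)) t =
      (\<Sum>g\<in>?F. if (\<Sum>j<?n. g j) = t then \<Prod>j<?n. S ! j ! g j else 0)"
    by (simp add: coeff_sum)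
  also have "\<dots> = (\<Sum>g\<in>{g \<in> ?F. (\<Sum>j<?n. g j) = t}. \<Prod>j<?n. S ! j ! g j)"
    by (rule sum.inter_filter[symmetric, OF fin])
  also have "\<dots> = (\<Sum>is\<in>outcomes ks t. \<Prod>j<?n. S ! j ! (is ! j))"
  proof (rule sum.reindex_bij_witness
      [where i = "\<lambda>is. restrict ((!) is) {..<?n}" and j = "\<lambda>g. map g [0..<?n]"])
    fix g assume g: "g \<in> {g \<in> ?F. (\<Sum>j<?n. g j) = t}"
    then have lt: "g j < ks ! j" if "j < ?n" for j
      using that by (auto simp: PiE_iff)
    show "restrict ((!) (map g [0..<?n])) {..<?n} = g"
      using g by (auto simp: fun_eq_iff PiE_iff extensional_def restrict_def)
    show "map g [0..<?n] \<in> outcomes ks t"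
      using g lt by (fastforce simp: outcomes_def)
    show "(\<Prod>j<?n. S ! j ! (map g [0..<?n] ! j)) = (\<Prod>j<?n. S ! j ! g j)"
      by simp
  next
    fix xs assume xs: "xs \<in> outcomes ks t"
    show "map (restrict ((!) xs) {..<?n}) [0..<?n] = xs"
      using xs by (auto simp: outcomes_def intro!: nth_equalityI)
    have "xs ! j < ks ! j" if "j < ?n" for j
      using xs pos[OF that] that by (fastforce simp: outcomes_def)
    then show "restrict ((!) xs) {..<?n} \<in> {g \<in> ?F. (\<Sum>j<?n. g j) = t}"
      using xs by (auto simp: outcomes_def)
  qed
  finally show ?thesis .
qed

lemma outcomes_eq_empty:
  assumes "max_total ks < t"
  shows "outcomes ks t = {}"
proof -
  have "(\<Sum>j<length ks. xs ! j) \<le> max_total ks" if "\<forall>j<length ks. xs ! j \<le> ks ! j - 1" for xs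
    unfolding max_total_def using that by (intro sum_mono) auto
  then show ?thesis
    using assms by (fastforce simp: outcomes_def)
qed

lemma total_distribution_eq_iff:
  assumes "sack ks S" "sack ks S'"
  shows "total_distribution ks S = total_distribution ks S' \<longleftrightarrow>
    (\<Prod>j<length ks. Poly (S ! j)) = (\<Prod>j<length ks. Poly (S' ! j))" (is "_ \<longleftrightarrow> ?P = ?P'")
proof -
  have "total_distribution ks S = total_distribution ks S' \<longleftrightarrow>
      (\<forall>t\<le>max_total ks. coeff ?P t = coeff ?P' t)"
    unfolding coeff_prod_Poly[OF assms(1)] coeff_prod_Poly[OF assms(2)] total_distribution_def
    by (auto simp: less_Suc_eq_le map_eq_conv simp del: upt_Suc)
  also have "\<dots> \<longleftrightarrow> ?P = ?P'"
    using outcomes_eq_empty[of ks]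
    by (auto simp: poly_eq_iff coeff_prod_Poly[OF assms(1)] coeff_prod_Poly[OF assms(2)])
      (metis (no_types, lifting) not_le sum.empty)
  finally show ?thesis .
qed

section \<open>Coins\<close>

definition coin_poly :: "'a::field poly \<Rightarrow> bool" where
  "coin_poly p \<longleftrightarrow> degree p \<le> 1 \<and> poly p 1 = 1"

lemma coin_poly_cases:
  assumes "coin_poly p"
  obtains "p = 1" | z where "poly p z = 0"
proof -
  obtain a b where p: "p = [:a, b:]"
    using assms degree1_coeffs[of p] degree_0_id[of p] unfolding coin_poly_def
    by (metis One_nat_def le_Suc_eq le_zero_eq pCons_0_0)
  show thesis
  proof (cases "b = 0")
    case True
    with p assms have "p = 1"
      by (simp add: coin_poly_def one_pCons)
    then show thesis by (rule that(1))
  next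
    case False
    with p have "poly p (- a / b) = 0"
      by simp
    then show thesis by (rule that(2))
  qed
qed

text \<open>
  Two values determine a polynomial of degree at most 1. The root is never 1, where the
  value is prescribed to be 1.
\<close>

lemma coin_poly_determined_by_root:
  assumes "coin_poly p" "coin_poly q" "poly p z = 0" "poly q z = 0"
  shows "p = q"
proof (rule poly_eqI_degree[of "{1, z}"])
  have "z \<noteq> 1"
    using assms by (auto simp: coin_poly_def)
  then show "degree p < card {1, z}" "degree q < card {1, z}"
    using assms by (auto simp: coin_poly_def)
qed (use assms in \<open>auto simp: coin_poly_def\<close>)

lemma poly_prod_mset_eq_0_iff:
  fixes N :: "'a::idom poly multiset"
  shows "poly (prod_mset N) z = 0 \<longleftrightarrow> (\<exists>q\<in>#N. poly q z = 0)"
  by (induction N) auto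

text \<open>
  The two sizes have to agree because a factor 1 leaves no trace in the product: it is only the
  number of factors that tells how many of them are 1.
\<close>

lemma coin_factorization_unique:
  assumes "\<forall>p\<in>#M. coin_poly p" "\<forall>p\<in>#N. coin_poly p"
    and "size M = size N" "prod_mset M = prod_mset N"
  shows "M = N"
  using assms
proof (induction "size M" arbitrary: M N rule: less_induct)
  case less
  show ?case
  proof (cases "\<exists>p\<in>#M. \<exists>z. poly p z = 0")
    case True
    then obtain p z where p: "p \<in># M" "poly p z = 0" by blast
    then obtain M' where M: "M = add_mset p M'"
      by (meson multi_member_split)
    \<comment> \<open>The root of \<open>p\<close> is a root of some factor on the other side, which must then be \<open>p\<close>.\<close>
    have "poly (prod_mset N) z = 0"
      using less.prems(4) M p by (metis mult_zero_left poly_mult prod_mset.add_mset)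
    then obtain q where q: "q \<in># N" "poly q z = 0"
      by (auto simp: poly_prod_mset_eq_0_iff)
    have "q = p"
      using coin_poly_determined_by_root[of q p z] less.prems p q by blast
    with q obtain N' where N: "N = add_mset p N'"
      by (meson multi_member_split)
    have "p \<noteq> 0"
      using less.prems(1) p by (auto simp: coin_poly_def)
    then have "M' = N'"
      using less.hyps[of M' N'] less.prems M N by simp
    with M N show ?thesis by simp
  next
    case False
    then have "\<forall>p\<in>#M. p = 1"
      using less.prems(1) coin_poly_cases by metis
    then have M: "M = replicate_mset (size M) 1"
      by (metis set_mset_subset_singletonD subsetI insertI1 singleton_iff)
    then have "prod_mset M = 1"
      by (metis power_one prod_mset_replicate_mset)
    with less.prems(4) have "prod_mset N = 1" by simp
    \<comment> \<open>A factor of 1 is a unit, so it has no root.\<close>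
    then have "poly q z \<noteq> 0" if "q \<in># N" for q z
      using that poly_prod_mset_eq_0_iff[of N z] by auto
    then have "\<forall>q\<in>#N. q = 1"
      using less.prems(2) coin_poly_cases by metis
    then have "N = replicate_mset (size N) 1"
      by (metis set_mset_subset_singletonD subsetI insertI1 singleton_iff)
    with M less.prems(3) show ?thesis by simp
  qed
qed

lemma coin_poly_Poly:
  assumes "pseudodie 2 p"
  shows "coin_poly (Poly p)"
proof -
  have "degree (Poly p) \<le> 1"
    using assms by (intro degree_le) (auto simp: pseudodie_def nth_default_def)
  then show ?thesis
    using assms by (simp add: coin_poly_def pseudodie_poly_at_1)
qed

lemma prod_mset_map_Poly:
  "prod_mset (mset (map Poly S)) = (\<Prod>j<length S. Poly (S ! j))"
proof -
  have "prod_mset (mset (map Poly S)) = prod_list (map Poly S)"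
    by (simp only: prod_mset_prod_list)
  then show ?thesis
    by (simp add: prod.list_conv_set_nth atLeast0LessThan)
qed

lemma coin_sacks_permuted:
  assumes S: "sack ks S" and S': "sack ks S'" and coins: "\<forall>j<length ks. ks ! j = 2"
    and eq: "(\<Prod>j<length ks. Poly (S ! j)) = (\<Prod>j<length ks. Poly (S' ! j))"
  shows "\<exists>\<sigma>. \<sigma> permutes {..<length ks} \<and> (\<forall>j<length ks. S' ! j = S ! (\<sigma> j))"
proof -
  have len: "length S = length ks" "length S' = length ks"
    using S S' by (auto simp: sack_def)
  have "mset (map Poly S') = mset (map Poly S)"
  proof (rule coin_factorization_unique)
    show "\<forall>p\<in>#mset (map Poly S'). coin_poly p"
      using S' coins by (auto simp: sack_def in_set_conv_nth intro!: coin_poly_Poly)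
    show "\<forall>p\<in>#mset (map Poly S). coin_poly p"
      using S coins by (auto simp: sack_def in_set_conv_nth intro!: coin_poly_Poly)
    show "size (mset (map Poly S')) = size (mset (map Poly S))"
      using len by simp
    show "prod_mset (mset (map Poly S')) = prod_mset (mset (map Poly S))"
      using eq len by (simp only: prod_mset_map_Poly)
  qed
  then obtain \<sigma> where \<sigma>: "\<sigma> permutes {..<length (map Poly S)}"
      "permute_list \<sigma> (map Poly S) = map Poly S'"
    by (rule mset_eq_permutation)
  have "S' ! j = S ! (\<sigma> j)" if "j < length ks" for j
  proof (rule Poly_inject_same_length)
    have \<sigma>j: "\<sigma> j < length ks"
      using permutes_in_image[OF \<sigma>(1), of j] that len by simp
    have "map Poly S' ! j = map Poly S ! \<sigma> j"
      using permute_list_nth[OF \<sigma>(1), of j] \<sigma>(2) that len by simp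
    then show "Poly (S' ! j) = Poly (S ! \<sigma> j)"
      using that \<sigma>j len by simp
    show "length (S' ! j) = length (S ! \<sigma> j)"
      using S S' coins that \<sigma>j by (auto simp: sack_def pseudodie_def)
  qed
  with \<sigma>(1) len show ?thesis by auto
qed

section \<open>Sacks of dice with a certain outcome\<close>

definition point_die :: "nat \<Rightarrow> nat \<Rightarrow> complex list" where
  "point_die k i = map (\<lambda>m. if m = i then 1 else 0) [0..<k]"

definition point_sack :: "nat list \<Rightarrow> (nat \<Rightarrow> nat) \<Rightarrow> complex list list" where
  "point_sack ks e = map (\<lambda>j. point_die (ks ! j) (e j)) [0..<length ks]"

lemma Poly_point_die: "i < k \<Longrightarrow> Poly (point_die k i) = monom 1 i"
  by (rule poly_eqI) (auto simp: point_die_def nth_default_def)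

lemma Poly_point_sack:
  "j < length ks \<Longrightarrow> e j < ks ! j \<Longrightarrow> Poly (point_sack ks e ! j) = monom 1 (e j)"
  by (simp add: point_sack_def Poly_point_die)

lemma sack_point_sack:
  assumes "\<And>j. j < length ks \<Longrightarrow> ks ! j \<ge> 2 \<and> e j < ks ! j"
  shows "sack ks (point_sack ks e)"
  using assms by (auto simp: sack_def pseudodie_def point_sack_def point_die_def)

lemma prod_Poly_point_sack:
  assumes "\<And>j. j < length ks \<Longrightarrow> e j < ks ! j"
  shows "(\<Prod>j<length ks. Poly (point_sack ks e ! j)) = monom 1 (\<Sum>j<length ks. e j)"
proof -
  have "(\<Prod>j<length ks. Poly (point_sack ks e ! j)) = (\<Prod>j<length ks. monom 1 (e j))"
    using assms by (intro prod.cong) (auto simp: Poly_point_sack)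
  then show ?thesis
    by (simp add: prod_monom)
qed

text \<open>
  A die of order at least 3 next to another die destroys uniqueness: the factor \<open>x\<close> occurs in
  \<open>x \<cdot> x \<cdot> 1 \<cdots> 1\<close> but not in \<open>x\<^sup>2 \<cdot> 1 \<cdot> 1 \<cdots> 1\<close>.
\<close>

lemma large_die_not_unique:
  assumes ks: "\<And>j. j < length ks \<Longrightarrow> ks ! j \<ge> 2"
    and ab: "a < length ks" "b < length ks" "a \<noteq> b" and a: "ks ! a \<noteq> 2"
  obtains S S' where "sack ks S" "sack ks S'"
    "total_distribution ks S = total_distribution ks S'"
    "\<nexists>\<sigma>. \<sigma> permutes {..<length ks} \<and> (\<forall>j<length ks. S' ! j = S ! (\<sigma> j))"
proof -
  define e where "e j = (if j = a then 2 else 0 :: nat)" for j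
  define e' where "e' j = (if j = a then 1 else 0) + (if j = b then 1 else 0 :: nat)" for j
  have less: "e j < ks ! j" "e' j < ks ! j" if "j < length ks" for j
    using ks[OF that] ks[OF ab(1)] a ab(3) by (auto simp: e_def e'_def)
  have sacks: "sack ks (point_sack ks e)" "sack ks (point_sack ks e')"
    using ks less by (auto intro!: sack_point_sack)
  have "(\<Sum>j<length ks. e j) = (\<Sum>j<length ks. e' j)"
    using ab by (simp add: e_def e'_def sum.distrib)
  then have total: "total_distribution ks (point_sack ks e) = total_distribution ks (point_sack ks e')"
    by (simp add: total_distribution_eq_iff[OF sacks] prod_Poly_point_sack less)
  have "\<nexists>\<sigma>. \<sigma> permutes {..<length ks} \<and>
      (\<forall>j<length ks. point_sack ks e' ! j = point_sack ks e ! (\<sigma> j))"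
  proof
    assume "\<exists>\<sigma>. \<sigma> permutes {..<length ks} \<and>
      (\<forall>j<length ks. point_sack ks e' ! j = point_sack ks e ! (\<sigma> j))"
    then obtain \<sigma> where \<sigma>: "\<sigma> permutes {..<length ks}"
      and eq: "point_sack ks e' ! a = point_sack ks e ! (\<sigma> a)"
      using ab(1) by blast
    have "\<sigma> a < length ks"
      using permutes_in_image[OF \<sigma>, of a] ab(1) by simp
    with eq have "monom (1::complex) (e' a) = monom 1 (e (\<sigma> a))"
      using ab(1) less Poly_point_sack by metis
    then have "e' a = e (\<sigma> a)"
      by (simp add: monom_eq_iff')
    then show False
      using ab(3) by (auto simp: e_def e'_def split: if_splits)
  qed
  with sacks total show thesis by (rule that)
qed

section \<open>Characterization\<close>

theorem corollary6p1p5: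
  fixes n :: nat and ks :: "nat list"
  assumes "n \<ge> 1"
    and "length ks = n"
    and "\<And>j. j < n \<Longrightarrow> ks ! j \<ge> 2"
  shows "(\<forall>S S'. sack ks S \<and> sack ks S' \<and> total_distribution ks S = total_distribution ks S' \<longrightarrow>
            (\<exists>\<sigma>. \<sigma> permutes {..<n} \<and> (\<forall>j<n. S' ! j = S ! (\<sigma> j))))
         \<longleftrightarrow> ((\<forall>j<n. ks ! j = 2) \<or> n = 1)"
    (is "?unique \<longleftrightarrow> ?coins \<or> _")
proof
  assume unique: ?unique
  show "?coins \<or> n = 1"
  proof (rule ccontr)
    assume neg: "\<not> (?coins \<or> n = 1)"
    then obtain a where a: "a < n" "ks ! a \<noteq> 2" by blast
    define b where "b = (if a = 0 then 1 else 0 :: nat)"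
    have "b < n" "a \<noteq> b"
      using neg assms(1) by (auto simp: b_def)
    then show False
      using large_die_not_unique[of ks a b] a assms(2,3) unique by metis
  qed
next
  assume cases: "?coins \<or> n = 1"
  show ?unique
  proof (intro allI impI, elim conjE)
    fix S S'
    assume S: "sack ks S" and S': "sack ks S'"
      and total: "total_distribution ks S = total_distribution ks S'"
    have prods: "(\<Prod>j<length ks. Poly (S ! j)) = (\<Prod>j<length ks. Poly (S' ! j))"
      using total total_distribution_eq_iff[OF S S'] by blast
    show "\<exists>\<sigma>. \<sigma> permutes {..<n} \<and> (\<forall>j<n. S' ! j = S ! (\<sigma> j))"
    proof (cases ?coins)
      case True
      then show ?thesis
        using coin_sacks_permuted[OF S S' _ prods] assms(2) by simp
    next
      case False
      with cases have n: "n = 1" by blast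
      have "S' ! 0 = S ! 0"
      proof (rule Poly_inject_same_length)
        show "Poly (S' ! 0) = Poly (S ! 0)"
          using prods n assms(2) by simp
        show "length (S' ! 0) = length (S ! 0)"
          using S S' n assms(2) by (simp add: sack_def pseudodie_def)
      qed
      with n have "id permutes {..<n} \<and> (\<forall>j<n. S' ! j = S ! (id j))"
        by (simp add: permutes_id)
      then show ?thesis by blast
    qed
  qed
qed

end
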